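(* Let $H(t_0,x_0)$ be the forward separable optimization problem defined in the context, and let $A(t_0,x_0)$ be the associated augmented problem defined in the context. Suppose $J_{t_0,x_0}(\mathbf{u},\mathbf{x})$ is forward separable with associated functions $\phi_i$. Then $J^*_{t_0,x_0}=L^*_{t_0,x_0}$. Furthermore, suppose $\mathbf{u}$ and $\mathbf{x}$ solve $H(t_0,x_0)$ and $\mathbf{w}$ and $\mathbf{z}=(z_1,z_2)$ solve $A(t_0,x_0)$. Then $\mathbf{u}=\mathbf{w}$ and $x(t)=z_1(t)$ for all $t$.
   Context: Data: $T\in\mathbb{N}$, $t_0\in\{0,\dots,T-1\}$, $x_0\in\mathbb{R}^n$, $X\subset\mathbb{R}^n$, $U\subset\mathbb{R}^p$, $f:\mathbb{R}^n\times\mathbb{R}^p\times\mathbb{N}\to\mathbb{R}^n$. For all $x$ and $t$ the set $\Gamma_{t,x}=\{u\in U: f[x,u,t]\in X\}$ is assumed nonempty. Class $G$: indexed problems $G(t_0,x_0)$ of minimizing an objective $J_{t_0,x_0}(\mathbf{u},\mathbf{x})$ over $\mathbf{u}=(u(t_0),\dots,u(T-1))$ and $\mathbf{x}=(x(t_0),\dots,x(T))$ subject to $x(t_0)=x_0$; $x(t+1)=f[x(t),u(t),t]$ and $u(t)\in U$ for $t=t_0,\dots,T-1$; $x(t)\in X$ for $t=t_0+1,\dots,T$. Class $P$: the problems of class $G$ whose objective has the form $J_{t_0,x_0}(\mathbf{u},\mathbf{x})=\sum_{t=t_0}^{T-1}c_t(x(t),u(t))+c_T(x(T))$ for given functions $c_t:\mathbb{R}^n\times\mathbb{R}^p\to\mathbb{R}$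 and $c_T:\mathbb{R}^n\to\mathbb{R}$. Forward separable: $J_{t_0,x_0}$ is forward separable with associated $\phi_i$ if, for some $q\in\mathbb{N}$, there exist functions $\phi_{t_0}:\mathbb{R}^n\times\mathbb{R}^p\to\mathbb{R}^q$, $\phi_t:\mathbb{R}^n\times\mathbb{R}^p\times\mathbb{R}^q\to\mathbb{R}^q$ for $t=t_0+1,\dots,T-1$, and $\phi_T:\mathbb{R}^n\times\mathbb{R}^q\to\mathbb{R}$ with $$J_{t_0,x_0}(\mathbf{u},\mathbf{x})=\phi_T\big(x(T),\phi_{T-1}[x(T-1),u(T-1),\phi_{T-2}\{\dots,\phi_{t_0+1}\{x(t_0+1),u(t_0+1),\phi_{t_0}\{x(t_0),u(t_0)\}\}\dots\}]\big).$$ $H(t_0,x_0)$: a problem of class $G$, but not of class $P$, whose objective $J_{t_0,x_0}$ is forward separable with associated $\phi_i$. $A(t_0,x_0)$: minimize $L_{t_0,x_0}(\mathbf{u},\mathbf{z})=z_2(T+1)$ over $\mathbf{u}=(u(t_0),\dots,u(T-1))$ and $\mathbf{z}=(z(t_0),\dots,z(T+1))$, $z(t)=(z_1(t),z_2(t))$, with $z_1(t)\in\mathbb{R}^n$, $z_2(t)\in\mathbb{R}^q$ for $t\le T$ and $z_2(T+1)\in\mathbb{R}$, subject to - $z_1(t_0)=x_0$, $z_2(t_0)=0$; - $z_1(t_0+1)=f[z_1(t_0),u(t_0),t_0]$, $z_2(t_0+1)=\phi_{t_0}(z_1(t_0),u(t_0))$; - $z_1(t+1)=f[z_1(t),u(t),t]$,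 $z_2(t+1)=\phi_t(z_1(t),u(t),z_2(t))$ for $t_0+1\le t\le T-1$; - $z_1(T+1)=z_1(T)$, $z_2(T+1)=\phi_T(z_1(T),z_2(T))$; - $z_1(t)\in X$ for $t=t_0+1,\dots,T$, and $u(t)\in U$ for $t=t_0,\dots,T-1$. A pair solves a problem if it is feasible and attains the minimum of the objective over feasible pairs; $J^*_{t_0,x_0}$ and $L^*_{t_0,x_0}$ denote the optimal values of $H(t_0,x_0)$ and $A(t_0,x_0)$. In "for all $t$", $t$ ranges over $t_0,\dots,T$.
   Formalization: The final claim (u = w and x(t) = z_1(t) for any solutions) fails if H has several minimizers; it is proved when H has a unique solution. In general, each solution of H is matched by some solution of A with the same controls and states, and conversely. *)

theory Defs
  imports "HOL-Analysis.Analysis"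
begin

text \<open>
  A finite tuple \<open>(u(t0), ..., u(T-1))\<close> is an extensional function on the index set
  \<open>{t0..<T}\<close>, so equality of tuples is equality in the logic.  Likewise for state
  trajectories on \<open>{t0..T}\<close>.
\<close>

definition feasible_G ::
  "nat \<Rightarrow> (real^'n) set \<Rightarrow> (real^'p) set \<Rightarrow> (real^'n \<Rightarrow> real^'p \<Rightarrow> nat \<Rightarrow> real^'n)
   \<Rightarrow> nat \<Rightarrow> real^'n \<Rightarrow> ((nat \<Rightarrow> real^'p) \<times> (nat \<Rightarrow> real^'n)) set" where
  "feasible_G T X U f t0 x0 =
    {(u, x). u \<in> {t0..<T} \<rightarrow>\<^sub>E U \<and> x \<in> {t0..T} \<rightarrow>\<^sub>E UNIV \<and>
       x t0 = x0 \<and>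
       (\<forall>t\<in>{t0..<T}. x (t + 1) = f (x t) (u t) t) \<and>
       (\<forall>t\<in>{t0<..T}. x t \<in> X)}"

definition class_P ::
  "nat \<Rightarrow> nat \<Rightarrow> ((nat \<Rightarrow> real^'p) \<Rightarrow> (nat \<Rightarrow> real^'n) \<Rightarrow> real) \<Rightarrow> bool" where
  "class_P T t0 J \<longleftrightarrow>
    (\<exists>(c :: nat \<Rightarrow> real^'n \<Rightarrow> real^'p \<Rightarrow> real) (cT :: real^'n \<Rightarrow> real).
      \<forall>u\<in>{t0..<T} \<rightarrow>\<^sub>E UNIV. \<forall>x\<in>{t0..T} \<rightarrow>\<^sub>E UNIV.
        J u x = (\<Sum>t=t0..<T. c t (x t) (u t)) + cT (x T))"

text \<open>
  \<open>nested \<phi>0 \<phi> t0 u x k\<close> is the nested expression whose outermost function is the one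
  with index \<open>t0 + k\<close>.
\<close>

primrec nested ::
  "(real^'n \<Rightarrow> real^'p \<Rightarrow> real^'q) \<Rightarrow> (nat \<Rightarrow> real^'n \<Rightarrow> real^'p \<Rightarrow> real^'q \<Rightarrow> real^'q)
   \<Rightarrow> nat \<Rightarrow> (nat \<Rightarrow> real^'p) \<Rightarrow> (nat \<Rightarrow> real^'n) \<Rightarrow> nat \<Rightarrow> real^'q" where
  "nested \<phi>0 \<phi> t0 u x 0 = \<phi>0 (x t0) (u t0)"
| "nested \<phi>0 \<phi> t0 u x (Suc k) =
     \<phi> (t0 + Suc k) (x (t0 + Suc k)) (u (t0 + Suc k)) (nested \<phi>0 \<phi> t0 u x k)"

text \<open>
  The three kinds of associated functions have different types: \<open>\<phi>0\<close> is the function with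
  index \<open>t0\<close>, \<open>\<phi> t\<close> the one with index \<open>t\<close> for \<open>t0 < t < T\<close>, and \<open>\<phi>T\<close> the terminal one.
  Taking \<open>q = CARD('q) \<ge> 1\<close> loses nothing: for \<open>q = 0\<close> the objective would depend on \<open>x(T)\<close>
  only, hence be of class P.
\<close>

definition forward_separable ::
  "nat \<Rightarrow> nat \<Rightarrow> ((nat \<Rightarrow> real^'p) \<Rightarrow> (nat \<Rightarrow> real^'n) \<Rightarrow> real)
   \<Rightarrow> (real^'n \<Rightarrow> real^'p \<Rightarrow> real^'q) \<Rightarrow> (nat \<Rightarrow> real^'n \<Rightarrow> real^'p \<Rightarrow> real^'q \<Rightarrow> real^'q)
   \<Rightarrow> (real^'n \<Rightarrow> real^'q \<Rightarrow> real) \<Rightarrow> bool" where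
  "forward_separable T t0 J \<phi>0 \<phi> \<phi>T \<longleftrightarrow>
    (\<forall>u\<in>{t0..<T} \<rightarrow>\<^sub>E UNIV. \<forall>x\<in>{t0..T} \<rightarrow>\<^sub>E UNIV.
       J u x = \<phi>T (x T) (nested \<phi>0 \<phi> t0 u x (T - 1 - t0)))"

text \<open>
  The last entry of \<open>z\<^sub>2\<close> is real while the others are vectors, so an augmented trajectory
  is a triple \<open>(z1, z2, \<zeta>)\<close> with \<open>z1\<close> on \<open>{t0..T+1}\<close>, \<open>z2\<close> on \<open>{t0..T}\<close>, and \<open>\<zeta>\<close> the
  value \<open>z\<^sub>2(T+1)\<close>.
\<close>

definition feasible_A ::
  "nat \<Rightarrow> (real^'n) set \<Rightarrow> (real^'p) set \<Rightarrow> (real^'n \<Rightarrow> real^'p \<Rightarrow> nat \<Rightarrow> real^'n)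
   \<Rightarrow> (real^'n \<Rightarrow> real^'p \<Rightarrow> real^'q) \<Rightarrow> (nat \<Rightarrow> real^'n \<Rightarrow> real^'p \<Rightarrow> real^'q \<Rightarrow> real^'q)
   \<Rightarrow> (real^'n \<Rightarrow> real^'q \<Rightarrow> real) \<Rightarrow> nat \<Rightarrow> real^'n
   \<Rightarrow> ((nat \<Rightarrow> real^'p) \<times> (nat \<Rightarrow> real^'n) \<times> (nat \<Rightarrow> real^'q) \<times> real) set" where
  "feasible_A T X U f \<phi>0 \<phi> \<phi>T t0 x0 =
    {(u, z1, z2, \<zeta>).
       u \<in> {t0..<T} \<rightarrow>\<^sub>E U \<and> z1 \<in> {t0..T+1} \<rightarrow>\<^sub>E UNIV \<and> z2 \<in> {t0..T} \<rightarrow>\<^sub>E UNIV \<and>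
       z1 t0 = x0 \<and> z2 t0 = 0 \<and>
       z1 (t0 + 1) = f (z1 t0) (u t0) t0 \<and> z2 (t0 + 1) = \<phi>0 (z1 t0) (u t0) \<and>
       (\<forall>t\<in>{t0<..<T}. z1 (t + 1) = f (z1 t) (u t) t \<and>
                      z2 (t + 1) = \<phi> t (z1 t) (u t) (z2 t)) \<and>
       z1 (T + 1) = z1 T \<and> \<zeta> = \<phi>T (z1 T) (z2 T) \<and>
       (\<forall>t\<in>{t0<..T}. z1 t \<in> X)}"

definition objective_A ::
  "(nat \<Rightarrow> real^'p) \<times> (nat \<Rightarrow> real^'n) \<times> (nat \<Rightarrow> real^'q) \<times> real \<Rightarrow> real" where
  "objective_A = (\<lambda>(u, z1, z2, \<zeta>). \<zeta>)"

definition solves :: "'a set \<Rightarrow> ('a \<Rightarrow> real) \<Rightarrow> 'a \<Rightarrow> bool" where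
  "solves S F p \<longleftrightarrow> is_arg_min F (\<lambda>p. p \<in> S) p"

text \<open>
  The optimal value is an extended real: no assumption makes the minimum attained or the
  objective bounded below on the feasible set.
\<close>

definition optimal_value :: "'a set \<Rightarrow> ('a \<Rightarrow> real) \<Rightarrow> ereal" where
  "optimal_value S F = (INF p\<in>S. ereal (F p))"

end

theory Submission
  imports Defs
begin

text \<open>
  In the augmented problem the second state component is an accumulator: the dynamics force
  \<open>z2 (t0 + k + 1)\<close> to equal the nested expression with outermost index \<open>t0 + k\<close>
  (\<open>accumulator_eq_nested\<close>), so the terminal value \<open>\<zeta>\<close> is exactly the forward separable
  objective evaluated at \<open>(u, z1)\<close>.  Computing the accumulator along a trajectory of the
  original problem, and forgetting it along an augmented one, are therefore
  objective-preserving maps between the two feasible sets.  Two such maps in opposite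
  directions give equal infima and send minimizers to minimizers, whether or not the
  infimum is attained.  Both maps leave the controls and the states on \<open>{t0..T}\<close> untouched,
  so the minimizers found on the two sides agree there; when the original problem has only
  one minimizer, every augmented minimizer must project to it.
\<close>

text \<open>
  Objective-preserving maps need not be bijections for minimizers to be transported: the map
  back only has to turn a hypothetical better competitor in \<open>S'\<close> into one in \<open>S\<close>.
\<close>

lemma solves_transfer:
  assumes "solves S F p"
    and "g p \<in> S'" and "F' (g p) = F p"
    and "\<And>q. q \<in> S' \<Longrightarrow> h q \<in> S \<and> F (h q) = F' q"
  shows "solves S' F' (g p)"
  using assms unfolding solves_def is_arg_min_def by metis

lemma optimal_value_mono_map:
  assumes "\<And>q. q \<in> S' \<Longrightarrow> h q \<in> S \<and> F (h q) = F' q"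
  shows "optimal_value S F \<le> optimal_value S' F'"
  unfolding optimal_value_def
proof (rule INF_greatest)
  fix q assume "q \<in> S'"
  with assms have "h q \<in> S" "F (h q) = F' q" by auto
  then show "(INF p\<in>S. ereal (F p)) \<le> ereal (F' q)"
    by (metis INF_lower)
qed

lemma nested_cong:
  assumes "\<And>t. t0 \<le> t \<Longrightarrow> t \<le> t0 + k \<Longrightarrow> x t = y t"
  shows "nested \<phi>0 \<phi> t0 u x k = nested \<phi>0 \<phi> t0 u y k"
  using assms by (induction k) auto

lemma accumulator_eq_nested:
  assumes "z2 (t0 + 1) = \<phi>0 (z1 t0) (u t0)"
    and "\<forall>t\<in>{t0<..<T}. z2 (t + 1) = \<phi> t (z1 t) (u t) (z2 t)"
    and "t0 + Suc k \<le> T"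
  shows "z2 (t0 + Suc k) = nested \<phi>0 \<phi> t0 u z1 k"
  using assms(3)
proof (induction k)
  case 0
  then show ?case using assms(1) by simp
next
  case (Suc k)
  have "t0 + Suc k \<in> {t0<..<T}" using Suc.prems by simp
  with assms(2) have "z2 (t0 + Suc k + 1) =
      \<phi> (t0 + Suc k) (z1 (t0 + Suc k)) (u (t0 + Suc k)) (z2 (t0 + Suc k))"
    by blast
  with Suc show ?case by simp
qed

text \<open>
  The problem prescribes the accumulator to be \<open>0\<close> at \<open>t0\<close>; the nested expressions
  begin one step later, hence the shift by \<open>Suc t0\<close>.  The extra state at \<open>T + 1\<close> copies the
  one at \<open>T\<close>.
\<close>

definition augment ::
  "nat \<Rightarrow> (real^'n \<Rightarrow> real^'p \<Rightarrow> real^'q) \<Rightarrow> (nat \<Rightarrow> real^'n \<Rightarrow> real^'p \<Rightarrow> real^'q \<Rightarrow> real^'q)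
   \<Rightarrow> (real^'n \<Rightarrow> real^'q \<Rightarrow> real) \<Rightarrow> nat
   \<Rightarrow> (nat \<Rightarrow> real^'p) \<times> (nat \<Rightarrow> real^'n)
   \<Rightarrow> (nat \<Rightarrow> real^'p) \<times> (nat \<Rightarrow> real^'n) \<times> (nat \<Rightarrow> real^'q) \<times> real" where
  "augment T \<phi>0 \<phi> \<phi>T t0 = (\<lambda>(u, x).
     (u,
      \<lambda>t\<in>{t0..T+1}. x (min t T),
      \<lambda>t\<in>{t0..T}. if t = t0 then 0 else nested \<phi>0 \<phi> t0 u x (t - Suc t0),
      \<phi>T (x T) (nested \<phi>0 \<phi> t0 u x (T - 1 - t0))))"

definition forget_accumulator ::
  "nat \<Rightarrow> nat \<Rightarrow> (nat \<Rightarrow> real^'p) \<times> (nat \<Rightarrow> real^'n) \<times> (nat \<Rightarrow> real^'q) \<times> real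
   \<Rightarrow> (nat \<Rightarrow> real^'p) \<times> (nat \<Rightarrow> real^'n)" where
  "forget_accumulator T t0 = (\<lambda>(u, z1, z2, \<zeta>). (u, restrict z1 {t0..T}))"

lemma augment_feasible:
  fixes f :: "real^'n \<Rightarrow> real^'p \<Rightarrow> nat \<Rightarrow> real^'n"
    and \<phi>0 :: "real^'n \<Rightarrow> real^'p \<Rightarrow> real^'q"
  assumes "t0 < T" and "(u, x) \<in> feasible_G T X U f t0 x0"
  shows "augment T \<phi>0 \<phi> \<phi>T t0 (u, x) \<in> feasible_A T X U f \<phi>0 \<phi> \<phi>T t0 x0"
proof -
  define z1 where "z1 = (\<lambda>t\<in>{t0..T+1}. x (min t T))"
  define z2 where
    "z2 = (\<lambda>t\<in>{t0..T}. if t = t0 then 0 else nested \<phi>0 \<phi> t0 u x (t - Suc t0))"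
  have z1: "z1 t = x t" if "t \<in> {t0..T}" for t
    using that by (simp add: z1_def min_def)
  have z2_Suc: "z2 (t0 + Suc k) = nested \<phi>0 \<phi> t0 u x k" if "t0 + Suc k \<le> T" for k
    using that by (simp add: z2_def)
  have x: "u \<in> {t0..<T} \<rightarrow>\<^sub>E U" "x t0 = x0"
    "\<And>t. t \<in> {t0..<T} \<Longrightarrow> x (t + 1) = f (x t) (u t) t"
    "\<And>t. t \<in> {t0<..T} \<Longrightarrow> x t \<in> X"
    using assms(2) by (auto simp: feasible_G_def)
  have step: "z2 (t + 1) = \<phi> t (z1 t) (u t) (z2 t)" if t: "t \<in> {t0<..<T}" for t
  proof -
    obtain k where k: "t = t0 + Suc k"
      using t less_iff_Suc_add by auto
    with t have "z2 (t + 1) = nested \<phi>0 \<phi> t0 u x (Suc k)" "z2 t = nested \<phi>0 \<phi> t0 u x k"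
      using z2_Suc[of "Suc k"] z2_Suc[of k] by auto
    with k t z1[of t] show ?thesis by simp
  qed
  have "z2 (t0 + 1) = \<phi>0 (z1 t0) (u t0)"
    using z2_Suc[of 0] z1[of t0] \<open>t0 < T\<close> by simp
  moreover have "z2 T = nested \<phi>0 \<phi> t0 u x (T - 1 - t0)"
    using \<open>t0 < T\<close> by (simp add: z2_def)
  moreover have "z2 t0 = 0" using \<open>t0 < T\<close> by (simp add: z2_def)
  moreover have "z1 (T + 1) = z1 T" using \<open>t0 < T\<close> by (simp add: z1_def)
  moreover have "z1 \<in> {t0..T+1} \<rightarrow>\<^sub>E UNIV" "z2 \<in> {t0..T} \<rightarrow>\<^sub>E UNIV"
    by (auto simp: z1_def z2_def)
  moreover have "augment T \<phi>0 \<phi> \<phi>T t0 (u, x)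
      = (u, z1, z2, \<phi>T (x T) (nested \<phi>0 \<phi> t0 u x (T - 1 - t0)))"
    by (simp add: augment_def z1_def z2_def)
  ultimately show ?thesis
    using x step z1 \<open>t0 < T\<close> by (simp add: feasible_A_def)
qed

lemma objective_augment:
  assumes "forward_separable T t0 J \<phi>0 \<phi> \<phi>T" and "(u, x) \<in> feasible_G T X U f t0 x0"
  shows "objective_A (augment T \<phi>0 \<phi> \<phi>T t0 (u, x)) = J u x"
proof -
  have "u \<in> {t0..<T} \<rightarrow>\<^sub>E UNIV" "x \<in> {t0..T} \<rightarrow>\<^sub>E UNIV"
    using assms(2) by (auto simp: feasible_G_def)
  with assms(1) show ?thesis
    by (simp add: forward_separable_def objective_A_def augment_def)
qed

lemma forget_accumulator_feasible:
  assumes "t0 < T" and "(u, z1, z2, \<zeta>) \<in> feasible_A T X U f \<phi>0 \<phi> \<phi>T t0 x0"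
  shows "forget_accumulator T t0 (u, z1, z2, \<zeta>) \<in> feasible_G T X U f t0 x0"
proof -
  have z: "u \<in> {t0..<T} \<rightarrow>\<^sub>E U" "z1 t0 = x0"
    "z1 (t0 + 1) = f (z1 t0) (u t0) t0"
    "\<And>t. t \<in> {t0<..<T} \<Longrightarrow> z1 (t + 1) = f (z1 t) (u t) t"
    "\<And>t. t \<in> {t0<..T} \<Longrightarrow> z1 t \<in> X"
    using assms(2) by (auto simp: feasible_A_def)
  have "z1 (t + 1) = f (z1 t) (u t) t" if "t \<in> {t0..<T}" for t
    using that z(3) z(4)[of t] by (cases "t = t0") auto
  with z \<open>t0 < T\<close> show ?thesis
    by (simp add: feasible_G_def forget_accumulator_def)
qed

text \<open>
  \<open>\<zeta>\<close> is \<open>\<phi>T\<close> applied to the last accumulator value, which is the nested expression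
  appearing in the forward separable form of \<open>J\<close>.
\<close>

lemma objective_forget_accumulator:
  assumes "t0 < T" and "forward_separable T t0 J \<phi>0 \<phi> \<phi>T"
    and "(u, z1, z2, \<zeta>) \<in> feasible_A T X U f \<phi>0 \<phi> \<phi>T t0 x0"
  shows "J u (restrict z1 {t0..T}) = \<zeta>"
proof -
  have z: "z2 (t0 + 1) = \<phi>0 (z1 t0) (u t0)"
    "\<forall>t\<in>{t0<..<T}. z2 (t + 1) = \<phi> t (z1 t) (u t) (z2 t)"
    "\<zeta> = \<phi>T (z1 T) (z2 T)" "u \<in> {t0..<T} \<rightarrow>\<^sub>E UNIV"
    using assms(3) by (auto simp: feasible_A_def)
  have "z2 (t0 + Suc (T - 1 - t0)) = nested \<phi>0 \<phi> t0 u z1 (T - 1 - t0)"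
    by (rule accumulator_eq_nested[where T = T]) (use z \<open>t0 < T\<close> in auto)
  also have "\<dots> = nested \<phi>0 \<phi> t0 u (restrict z1 {t0..T}) (T - 1 - t0)"
    by (rule nested_cong) (use \<open>t0 < T\<close> in auto)
  finally have "z2 T = nested \<phi>0 \<phi> t0 u (restrict z1 {t0..T}) (T - 1 - t0)"
    using \<open>t0 < T\<close> by simp
  moreover have "J u (restrict z1 {t0..T}) =
      \<phi>T (restrict z1 {t0..T} T) (nested \<phi>0 \<phi> t0 u (restrict z1 {t0..T}) (T - 1 - t0))"
    using assms(2) z(4) by (simp add: forward_separable_def)
  ultimately show ?thesis using z(3) \<open>t0 < T\<close> by simp
qed

theorem lemma4:
  fixes T t0 :: nat and x0 :: "real^'n"
    and X :: "(real^'n) set" and U :: "(real^'p) set"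
    and f :: "real^'n \<Rightarrow> real^'p \<Rightarrow> nat \<Rightarrow> real^'n"
    and J :: "(nat \<Rightarrow> real^'p) \<Rightarrow> (nat \<Rightarrow> real^'n) \<Rightarrow> real"
    and \<phi>0 :: "real^'n \<Rightarrow> real^'p \<Rightarrow> real^'q"
    and \<phi> :: "nat \<Rightarrow> real^'n \<Rightarrow> real^'p \<Rightarrow> real^'q \<Rightarrow> real^'q"
    and \<phi>T :: "real^'n \<Rightarrow> real^'q \<Rightarrow> real"
  defines "FH \<equiv> feasible_G T X U f t0 x0"
    and "FA \<equiv> feasible_A T X U f \<phi>0 \<phi> \<phi>T t0 x0"
  assumes "t0 < T"
    and "\<forall>t\<in>{t0..T}. \<forall>x. {u \<in> U. f x u t \<in> X} \<noteq> {}"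
    and "\<not> class_P T t0 J"
    and "forward_separable T t0 J \<phi>0 \<phi> \<phi>T"
  shows
    "optimal_value FH (\<lambda>(u, x). J u x) = optimal_value FA objective_A \<and>
     (\<forall>u x. solves FH (\<lambda>(u, x). J u x) (u, x) \<longrightarrow>
        (\<exists>w z1 z2 \<zeta>. solves FA objective_A (w, z1, z2, \<zeta>) \<and>
           u = w \<and> (\<forall>t\<in>{t0..T}. x t = z1 t))) \<and>
     (\<forall>w z1 z2 \<zeta>. solves FA objective_A (w, z1, z2, \<zeta>) \<longrightarrow>
        (\<exists>u x. solves FH (\<lambda>(u, x). J u x) (u, x) \<and>
           u = w \<and> (\<forall>t\<in>{t0..T}. x t = z1 t))) \<and>
     ((\<exists>!p. solves FH (\<lambda>(u, x). J u x) p) \<longrightarrow>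
        (\<forall>u x w z1 z2 \<zeta>.
           solves FH (\<lambda>(u, x). J u x) (u, x) \<and> solves FA objective_A (w, z1, z2, \<zeta>) \<longrightarrow>
           u = w \<and> (\<forall>t\<in>{t0..T}. x t = z1 t)))"
proof -
  let ?J = "\<lambda>(u, x). J u x"
  let ?aug = "augment T \<phi>0 \<phi> \<phi>T t0"
  let ?forget = "forget_accumulator T t0
    :: _ \<times> _ \<times> (nat \<Rightarrow> real^'q) \<times> real \<Rightarrow> _"
  have aug: "?aug p \<in> FA \<and> objective_A (?aug p) = ?J p" if "p \<in> FH" for p
    using that augment_feasible[OF \<open>t0 < T\<close>] objective_augment[OF assms(6)]
    unfolding FH_def FA_def by (cases p) auto
  have forget: "?forget q \<in> FH \<and> ?J (?forget q) = objective_A q" if "q \<in> FA" for q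
  proof -
    obtain u z1 z2 \<zeta> where q: "q = (u, z1, z2, \<zeta>)" by (cases q)
    with that have "(u, z1, z2, \<zeta>) \<in> feasible_A T X U f \<phi>0 \<phi> \<phi>T t0 x0"
      by (simp add: FA_def)
    from forget_accumulator_feasible[OF \<open>t0 < T\<close> this]
      objective_forget_accumulator[OF \<open>t0 < T\<close> assms(6) this]
    show ?thesis
      by (simp add: q FH_def objective_A_def forget_accumulator_def)
  qed
  have values_eq: "optimal_value FH ?J = optimal_value FA objective_A"
    by (rule antisym; rule optimal_value_mono_map) (use aug forget in blast)+
  have solves_aug: "solves FA objective_A (?aug p)" if "solves FH ?J p" for p
  proof -
    have "p \<in> FH" using that by (simp add: solves_def is_arg_min_def)
    then show ?thesis
      using aug forget
      by (intro solves_transfer[where g = ?aug and h = ?forget, OF that]) blast+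
  qed
  have solves_forget: "solves FH ?J (?forget q)" if "solves FA objective_A q" for q
  proof -
    have "q \<in> FA" using that by (simp add: solves_def is_arg_min_def)
    then show ?thesis
      using aug forget
      by (intro solves_transfer[where g = ?forget and h = ?aug, OF that]) blast+
  qed
  have H_to_A: "\<exists>w z1 z2 \<zeta>. solves FA objective_A (w, z1, z2, \<zeta>) \<and>
      u = w \<and> (\<forall>t\<in>{t0..T}. x t = z1 t)" if "solves FH ?J (u, x)" for u x
  proof -
    obtain z1 z2 \<zeta> where a: "?aug (u, x) = (u, z1, z2, \<zeta>)"
      and z1: "z1 = (\<lambda>t\<in>{t0..T+1}. x (min t T))"
      by (simp add: augment_def)
    have "solves FA objective_A (u, z1, z2, \<zeta>)"
      using solves_aug[OF that] unfolding a .
    moreover have "\<forall>t\<in>{t0..T}. x t = z1 t"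
      by (simp add: z1 min_def)
    ultimately show ?thesis by blast
  qed
  have forgotten: "solves FH ?J (w, restrict z1 {t0..T})"
    if "solves FA objective_A (w, z1, z2, \<zeta>)" for w z1 z2 \<zeta>
    using solves_forget[OF that] by (simp add: forget_accumulator_def)
  have A_to_H: "\<exists>u x. solves FH ?J (u, x) \<and> u = w \<and> (\<forall>t\<in>{t0..T}. x t = z1 t)"
    if "solves FA objective_A (w, z1, z2, \<zeta>)" for w z1 z2 \<zeta>
  proof -
    have "\<forall>t\<in>{t0..T}. restrict z1 {t0..T} t = z1 t" by simp
    with forgotten[OF that] show ?thesis by blast
  qed
  have unique: "u = w \<and> (\<forall>t\<in>{t0..T}. x t = z1 t)"
    if "\<exists>!p. solves FH ?J p" "solves FH ?J (u, x)" "solves FA objective_A (w, z1, z2, \<zeta>)"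
    for u x w z1 z2 \<zeta>
  proof -
    have "(u, x) = (w, restrict z1 {t0..T})"
      using that(1,2) forgotten[OF that(3)] by blast
    then show ?thesis by simp
  qed
  show ?thesis
    using values_eq H_to_A A_to_H unique by blast
qed

end
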